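(* Let $a$ be an integer, $v\in\mathbb{C}$ and $n\in\mathbb{N}_0$. Then $$e^{-\frac{v t^2}{2}}B_n^{(a)}(x)={}_H\beta_n^{(a)}(x,v),$$ where the power series $e^{-\frac{vt^2}{2}}$ acts on the polynomial $B_n^{(a)}(x)$ as a linear operator in $x$, with $t$ acting as $\frac{d}{dx}$.
   Context: $\mathbb{N}_0=\{0,1,2,\dots\}$. A formal power series $f(t)=\sum_{k\ge0}\frac{a_k}{k!}t^k$ over $\mathbb{C}$ acts as a linear operator on $\mathbb{C}[x]$ by $f(t)p(x)=\sum_{k\ge0}\frac{a_k}{k!}p^{(k)}(x)$ (a finite sum), i.e. $t$ acts as $d/dx$. The Bernoulli polynomials of order $a$ are defined by $\left(\frac{t}{e^t-1}\right)^a e^{xt}=\sum_{n\ge0}B_n^{(a)}(x)\frac{t^n}{n!}$, and the polynomials ${}_H\beta_n^{(a)}(x,v)$ by $\left(\frac{t}{e^t-1}\right)^a e^{xt-\frac{v t^2}{2}}=\sum_{n\ge0}{}_H\beta_n^{(a)}(x,v)\frac{t^n}{n!}$, as formal power series in $t$. *)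

theory Defs
  imports Complex_Main "HOL-Computational_Algebra.Computational_Algebra"
begin

(* A series with coefficients in C is also a series with coefficients in C[x]. *)
definition fps_lift :: "complex fps \<Rightarrow> complex poly fps" where
  "fps_lift f = Abs_fps (\<lambda>n. [:fps_nth f n:])"

(* e^g for a power series g in t over C[x] without constant term. The library's
   fps_exp requires coefficients in a field, hence the composition with the lifted series;
   fps_compose is meaningful only if the constant term of g vanishes. *)
definition fps_poly_exp :: "complex poly fps \<Rightarrow> complex poly fps" where
  "fps_poly_exp g = fps_compose (fps_lift (fps_exp 1)) g"

(* (t/(e^t-1))^a. The division is the exact one of formal power series, and the quotient
   has constant term 1, hence is a unit, so that powi is the true a-th power also for a < 0. *)
definition bernoulli_factor :: "int \<Rightarrow> complex fps" where
  "bernoulli_factor a = (fps_X / (fps_exp 1 - 1)) powi a"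

(* Here fps_X is t, and the polynomial [:0, 1:] is the indeterminate x of C[x]. *)
definition bernoulli_poly :: "int \<Rightarrow> nat \<Rightarrow> complex poly" where
  "bernoulli_poly a n = smult (fact n)
     (fps_nth (fps_lift (bernoulli_factor a) * fps_poly_exp (fps_const [:0, 1:] * fps_X)) n)"

(* The polynomial in x obtained from H-beta_n^(a)(x,v) for a given complex number v. *)
definition hermite_bernoulli_poly :: "int \<Rightarrow> complex \<Rightarrow> nat \<Rightarrow> complex poly" where
  "hermite_bernoulli_poly a v n = smult (fact n)
     (fps_nth (fps_lift (bernoulli_factor a) *
       fps_poly_exp (fps_const [:0, 1:] * fps_X - fps_const [:v / 2:] * fps_X ^ 2)) n)"

(* The coefficient fps_nth f k is a_k/k!; derivatives of order above the degree of p vanish. *)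
definition fps_diff_op :: "complex fps \<Rightarrow> complex poly \<Rightarrow> complex poly" where
  "fps_diff_op f p = (\<Sum>k\<le>degree p. smult (fps_nth f k) ((pderiv ^^ k) p))"

end

theory Submission
  imports Defs
begin

text \<open>
  Write \<open>P\<close> for the generating series of the \<open>B\<^sub>n\<^sup>(\<^sup>a\<^sup>)(x) / n!\<close>. Differentiation in \<open>x\<close> multiplies \<open>P\<close> by
  \<open>t\<close>, so a power series in \<open>d/dx\<close> acts on the coefficients of \<open>P\<close> as multiplication of \<open>P\<close> by that
  power series in \<open>t\<close>. It remains to see that the exponential of a sum is the product of the
  exponentials, which holds because both sides solve the same linear differential equation in \<open>t\<close>.
\<close>

text \<open>The difference \<open>D\<close> solves the same equation with zero constant term, and
  each coefficient \<open>Suc m\<close> of \<open>D\<close> is determined by the earlier ones.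
  Dividing by \<open>Suc m\<close> is only cancellation, so coefficients in C[x] are
  allowed.\<close>

lemma fps_linear_ode_unique:
  fixes F G :: "'a :: {idom, ring_char_0} fps"
  assumes "fps_deriv F = u * F" and "fps_deriv G = u * G"
    and "fps_nth F 0 = fps_nth G 0"
  shows "F = G"
proof -
  define D where "D = F - G"
  have D: "fps_deriv D = u * D" "fps_nth D 0 = 0"
    using assms by (simp_all add: D_def algebra_simps)
  have "fps_nth D n = 0" for n
  proof (induction n rule: less_induct)
    case (less n)
    show ?case
    proof (cases n)
      case 0
      then show ?thesis using D by simp
    next
      case (Suc m)
      have "of_nat (Suc m) * fps_nth D (Suc m) = fps_nth (u * D) m"
        by (simp flip: D(1))
      also have "\<dots> = 0"
        unfolding fps_mult_nth using less Suc by (intro sum.neutral) auto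
      finally show ?thesis
        using Suc by (simp del: of_nat_Suc)
    qed
  qed
  then show ?thesis
    by (simp add: D_def fps_eq_iff)
qed

lemma fps_nth_lift [simp]: "fps_nth (fps_lift f) n = [:fps_nth f n:]"
  by (simp add: fps_lift_def)

lemma sum_const_poly: "(\<Sum>i\<in>A. [:f i:]) = [:\<Sum>i\<in>A. f i:]"
  by (induction A rule: infinite_finite_induct) auto

lemma fps_lift_mult: "fps_lift (f * g) = fps_lift f * fps_lift g"
  by (simp add: fps_eq_iff fps_mult_nth sum_const_poly mult.commute)

lemma fps_deriv_lift: "fps_deriv (fps_lift f) = fps_lift (fps_deriv f)"
  by (simp add: fps_eq_iff of_nat_poly del: of_nat_Suc)

lemma fps_deriv_poly_exp:
  assumes "fps_nth g 0 = 0"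
  shows "fps_deriv (fps_poly_exp g) = fps_deriv g * fps_poly_exp g"
  using assms by (simp add: fps_poly_exp_def fps_compose_deriv fps_deriv_lift mult.commute)

lemma fps_nth_poly_exp_0 [simp]: "fps_nth (fps_poly_exp g) 0 = 1"
  by (simp add: fps_poly_exp_def one_pCons)

text \<open>Both sides have constant term 1 and logarithmic derivative
  \<open>fps_deriv g + fps_lift (fps_deriv h)\<close>. Exponentiating \<open>h\<close> before
  lifting gives a complex series, which can act as an operator.\<close>

lemma fps_poly_exp_add_lift:
  assumes g: "fps_nth g 0 = 0" and h: "fps_nth h 0 = 0"
  shows "fps_poly_exp (g + fps_lift h) = fps_lift (fps_compose (fps_exp 1) h) * fps_poly_exp g"
proof (rule fps_linear_ode_unique)
  show "fps_deriv (fps_poly_exp (g + fps_lift h)) =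
      (fps_deriv g + fps_lift (fps_deriv h)) * fps_poly_exp (g + fps_lift h)"
    using g h by (simp add: fps_deriv_poly_exp fps_deriv_lift)
  have "fps_deriv (fps_lift (fps_compose (fps_exp 1) h)) =
      fps_lift (fps_deriv h) * fps_lift (fps_compose (fps_exp 1) h)"
    using h by (simp add: fps_deriv_lift fps_compose_deriv fps_lift_mult mult.commute)
  then show "fps_deriv (fps_lift (fps_compose (fps_exp 1) h) * fps_poly_exp g) =
      (fps_deriv g + fps_lift (fps_deriv h)) *
        (fps_lift (fps_compose (fps_exp 1) h) * fps_poly_exp g)"
    using g by (simp add: fps_deriv_poly_exp algebra_simps)
qed (simp add: one_pCons)

lemma pderiv_nth_poly_exp:
  "pderiv (fps_nth (fps_poly_exp (fps_const [:0, 1:] * fps_X)) n) =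
    fps_nth (fps_X * fps_poly_exp (fps_const [:0, 1:] * fps_X)) n"
proof (cases n)
  case (Suc m)
  have "pderiv ([:0, 1:] ^ Suc m :: complex poly) = of_nat (Suc m) * [:0, 1:] ^ m"
    by (simp add: pderiv_power_Suc pderiv_pCons of_nat_poly del: of_nat_Suc power_Suc)
  then show ?thesis using Suc
    unfolding fps_poly_exp_def fps_compose_linear
    by (simp add: pderiv_smult of_nat_poly del: of_nat_Suc power_Suc)
qed (simp add: pderiv_1)

text \<open>Lifted coefficients are constant in x, so d/dx passes them and acts on \<open>F\<close>
  alone.\<close>

lemma pderiv_nth_lift_mult:
  assumes "\<And>n. pderiv (fps_nth F n) = fps_nth (fps_X * F) n"
  shows "pderiv (fps_nth (fps_lift f * F) n) = fps_nth (fps_X * (fps_lift f * F)) n"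
proof -
  have "pderiv (fps_nth (fps_lift f * F) n) = fps_nth (fps_lift f * (fps_X * F)) n"
    \<comment> \<open>The instance at 1 is the additivity of \<open>pderiv\<close> over finite
      sums.\<close>
    unfolding fps_mult_nth[of "fps_lift f"] higher_pderiv_sum[of 1, simplified]
    by (simp add: pderiv_smult assms del: fps_X_mult_nth)
  then show ?thesis
    by (simp only: mult.left_commute)
qed

lemma higher_pderiv_nth:
  assumes "\<And>n. pderiv (fps_nth F n) = fps_nth (fps_X * F) n"
  shows "(pderiv ^^ k) (fps_nth F n) = (if k \<le> n then fps_nth F (n - k) else 0)"
proof (induction k)
  case (Suc k)
  then show ?case
    \<comment> \<open>For \<open>k = n\<close> this uses that \<open>fps_X * F\<close> has constant
      term 0.\<close>
    using assms[of "n - k"] by auto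
qed simp

lemma higher_pderiv_eq_0: "degree p < k \<Longrightarrow> (pderiv ^^ k) p = 0"
  by (simp add: poly_eq_iff coeff_higher_pderiv coeff_eq_0)

lemma fps_diff_op_nth:
  assumes "\<And>n. pderiv (fps_nth F n) = fps_nth (fps_X * F) n"
  shows "fps_diff_op f (fps_nth F n) = fps_nth (fps_lift f * F) n"
proof -
  define T where "T k = smult (fps_nth f k) ((pderiv ^^ k) (fps_nth F n))" for k
  have T: "T k = (if k \<le> n then [:fps_nth f k:] * fps_nth F (n - k) else 0)" for k
    by (simp add: T_def higher_pderiv_nth[OF assms])
  have "T k = 0" if "degree (fps_nth F n) < k" for k
    using that by (simp add: T_def higher_pderiv_eq_0)
  \<comment> \<open>The operator sums up to the degree, the Cauchy product up to \<open>n\<close>.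
    Passing through the maximum avoids computing the degree: terms beyond either bound
    vanish.\<close>
  then have "sum T {..degree (fps_nth F n)} = sum T {..max n (degree (fps_nth F n))}"
    by (intro sum.mono_neutral_left) auto
  also have "\<dots> = sum T {..n}"
    by (intro sum.mono_neutral_right) (auto simp: T)
  also have "\<dots> = fps_nth (fps_lift f * F) n"
    by (auto simp: T fps_mult_nth atLeast0AtMost intro!: sum.cong)
  finally show ?thesis
    by (simp add: fps_diff_op_def T_def)
qed

lemma fps_diff_op_smult: "fps_diff_op f (smult c p) = smult c (fps_diff_op f p)"
\<comment> \<open>The range of summation depends on the degree, which \<open>smult c\<close>
  preserves only for nonzero \<open>c\<close>.\<close>
proof (cases "c = 0")
  case False
  then have "fps_diff_op f (smult c p) =
      (\<Sum>k\<le>degree p. [:c:] * smult (fps_nth f k) ((pderiv ^^ k) p))"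
    by (simp add: fps_diff_op_def higher_pderiv_smult mult.commute)
  also have "\<dots> = [:c:] * fps_diff_op f p"
    by (simp only: fps_diff_op_def sum_distrib_left)
  finally show ?thesis
    by simp
qed (simp add: fps_diff_op_def)

theorem theorem7:
  fixes a :: int and v :: complex and n :: nat
  shows "fps_diff_op (fps_compose (fps_exp 1) (- (fps_const (v / 2) * fps_X ^ 2))) (bernoulli_poly a n)
    = hermite_bernoulli_poly a v n"
proof -
  define h :: "complex fps" where "h = - (fps_const (v / 2) * fps_X ^ 2)"
  define E where "E = fps_poly_exp (fps_const [:0, 1:] * fps_X)"
  define B where "B = fps_lift (bernoulli_factor a)"
  have "fps_lift h = - (fps_const [:v / 2:] * fps_X ^ 2)"
    by (simp add: fps_eq_iff h_def fps_X_power_nth)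
  then have "fps_poly_exp (fps_const [:0, 1:] * fps_X - fps_const [:v / 2:] * fps_X ^ 2) =
      fps_lift (fps_compose (fps_exp 1) h) * E"
    using fps_poly_exp_add_lift[of "fps_const [:0, 1:] * fps_X" h] by (simp add: E_def h_def)
  \<comment> \<open>\<open>E\<close> is e^(xt), on which d/dx acts as t; the product
    \<open>B * E\<close> inherits this.\<close>
  moreover have "fps_diff_op (fps_compose (fps_exp 1) h) (fps_nth (B * E) n) =
      fps_nth (fps_lift (fps_compose (fps_exp 1) h) * (B * E)) n"
    unfolding B_def E_def by (intro fps_diff_op_nth pderiv_nth_lift_mult pderiv_nth_poly_exp)
  ultimately show ?thesis
    by (simp add: bernoulli_poly_def hermite_bernoulli_poly_def fps_diff_op_smult
        mult.left_commute flip: h_def E_def B_def)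
qed

end
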